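(* Let $\mathcal{S}$ be an $(A,H,C,G_y)$-self hidden subspace and let $\mathcal{V}$ be an $(A,B,E,D_z)$-self bounded subspace. Let $K\in\mathbb{R}^{m\times p}$ be such that $(\mathcal{S},\mathcal{V};K)$ is a solution triple for DDPDOF. Then, for every $(A,H,C,G_y)$-self hidden subspace $\bar{\mathcal{S}}$ and every $(A,B,E,D_z)$-self bounded subspace $\bar{\mathcal{V}}$ that satisfy (i) $\operatorname{im}\begin{bmatrix}H\\ G_z\end{bmatrix}\subseteq(\bar{\mathcal{V}}\oplus 0_{\mathcal{Z}})+\operatorname{im}\begin{bmatrix}B\\ D_z\end{bmatrix}$, (ii) $\ker[\,E\ \ G_z\,]\supseteq(\bar{\mathcal{S}}\oplus\mathcal{W})\cap\ker[\,C\ \ G_y\,]$, (iii) $\bar{\mathcal{S}}\subseteq\bar{\mathcal{V}}$, the triple $(\bar{\mathcal{S}},\bar{\mathcal{V}};K)$ is a solution triple for DDPDOF.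
   Context: Plant: $\mathcal{D}x=Ax+Bu+Hw$, $y=Cx+D_yu+G_yw$, $z=Ex+D_zu+G_zw$, with real matrices, $x\in\mathcal{X}=\mathbb{R}^n$, control $u\in\mathcal{U}=\mathbb{R}^m$, disturbance $w\in\mathcal{W}=\mathbb{R}^q$, measurement $y\in\mathcal{Y}=\mathbb{R}^p$, to-be-controlled output $z\in\mathcal{Z}=\mathbb{R}^r$ ($\mathcal{D}$ is the time derivative or the unit shift). $0_{\mathcal{Z}}$ is the zero subspace of $\mathcal{Z}$. Geometric notions, for a generic quadruple $(A,B,C,D)$ with state space $\mathcal{X}$, input space $\mathcal{U}$, output space $\mathcal{Y}$ (applied with other matrices and the corresponding input/output spaces). A subspace $\mathcal{V}\subseteq\mathcal{X}$ is $(A,B,C,D)$-output nulling if $\begin{bmatrix}A\\ C\end{bmatrix}\mathcal{V}\subseteq(\mathcal{V}\oplus 0_{\mathcal{Y}})+\operatorname{im}\begin{bmatrix}B\\ D\end{bmatrix}$; the largest such subspace is $\mathcal{V}^\star_{(A,B,C,D)}$. An output nulling $\mathcal{V}$ is $(A,B,C,D)$-self bounded if $\mathcal{V}\supseteq\mathcal{V}^\star_{(A,B,C,D)}\cap B\ker D$. A subspace $\mathcal{S}\subseteq\mathcal{X}$ is $(A,B,C,D)$-input containing if $[\,A\ \ B\,]\bigl((\mathcal{S}\oplus\mathcal{U})\cap\ker[\,C\ \ D\,]\bigr)\subseteq\mathcal{S}$; the smallest such subspace is $\mathcal{S}^\star_{(A,B,C,D)}$. An input containing $\mathcal{S}$ is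 $(A,B,C,D)$-self hidden if $\mathcal{S}\subseteq\mathcal{S}^\star_{(A,B,C,D)}+C^{-1}\operatorname{im}D$. Solution triple for DDPDOF (the disturbance decoupling problem by dynamic output feedback): $(\mathcal{S},\mathcal{V};K)$ with $\mathcal{V}$ $(A,B,E,D_z)$-output nulling, $\mathcal{S}$ $(A,H,C,G_y)$-input containing, and $K\in\mathbb{R}^{m\times p}$, such that (i) $\operatorname{im}\begin{bmatrix}H\\ G_z\end{bmatrix}\subseteq(\mathcal{V}\oplus 0_{\mathcal{Z}})+\operatorname{im}\begin{bmatrix}B\\ D_z\end{bmatrix}$; (ii) $\ker[\,E\ \ G_z\,]\supseteq(\mathcal{S}\oplus\mathcal{W})\cap\ker[\,C\ \ G_y\,]$; (iii) $\mathcal{S}\subseteq\mathcal{V}$; (iv) $I+KD_y$ is nonsingular and $\begin{bmatrix}A+BKC&H+BKG_y\\ E+D_zKC&G_z+D_zKG_y\end{bmatrix}(\mathcal{S}\oplus\mathcal{W})\subseteq\mathcal{V}\oplus 0_{\mathcal{Z}}$. *)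

theory Defs
  imports "HOL-Analysis.Analysis"
begin

text \<open>
  External direct sums of spaces are product types, block matrices act on pairs, and the sum of
  two subspaces is the elementwise sum of sets from \<^theory>\<open>HOL-Library.Set_Algebras\<close>.
  Thus \<open>V \<times> {0}\<close> is the direct sum of \<open>V\<close> and the zero subspace,
  and \<open>S \<times> UNIV\<close> is the direct sum of \<open>S\<close> and the whole input space.
\<close>

definition block_col :: "real^'n^'a \<Rightarrow> real^'n^'b \<Rightarrow> real^'n \<Rightarrow> (real^'a) \<times> (real^'b)" where
  "block_col M N x = (M *v x, N *v x)"

definition block_row :: "real^'a^'n \<Rightarrow> real^'b^'n \<Rightarrow> (real^'a) \<times> (real^'b) \<Rightarrow> real^'n" where
  "block_row M N = (\<lambda>(x, u). M *v x + N *v u)"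

definition block_mat ::
  "real^'a^'c \<Rightarrow> real^'b^'c \<Rightarrow> real^'a^'d \<Rightarrow> real^'b^'d
    \<Rightarrow> (real^'a) \<times> (real^'b) \<Rightarrow> (real^'c) \<times> (real^'d)" where
  "block_mat M N P Q v = (block_row M N v, block_row P Q v)"

definition ker :: "('a \<Rightarrow> 'b::zero) \<Rightarrow> 'a set" where
  "ker f = {v. f v = 0}"

definition output_nulling ::
  "real^'n^'n \<Rightarrow> real^'m^'n \<Rightarrow> real^'n^'p \<Rightarrow> real^'m^'p \<Rightarrow> (real^'n) set \<Rightarrow> bool" where
  "output_nulling A B C D V \<longleftrightarrow>
     subspace V \<and> block_col A C ` V \<subseteq> V \<times> {0} + range (block_col B D)"

definition input_containing ::
  "real^'n^'n \<Rightarrow> real^'m^'n \<Rightarrow> real^'n^'p \<Rightarrow> real^'m^'p \<Rightarrow> (real^'n) set \<Rightarrow> bool" where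
  "input_containing A B C D S \<longleftrightarrow>
     subspace S \<and> block_row A B ` ((S \<times> UNIV) \<inter> ker (block_row C D)) \<subseteq> S"

text \<open>
  The order on sets is inclusion; that the extremal subspaces below exist is shown by
  \<open>output_nulling_Vstar\<close>, \<open>Vstar_greatest\<close>, \<open>input_containing_Sstar\<close> and \<open>Sstar_least\<close>.
\<close>

definition Vstar ::
  "real^'n^'n \<Rightarrow> real^'m^'n \<Rightarrow> real^'n^'p \<Rightarrow> real^'m^'p \<Rightarrow> (real^'n) set" where
  "Vstar A B C D = (GREATEST V. output_nulling A B C D V)"

definition Sstar ::
  "real^'n^'n \<Rightarrow> real^'m^'n \<Rightarrow> real^'n^'p \<Rightarrow> real^'m^'p \<Rightarrow> (real^'n) set" where
  "Sstar A B C D = (LEAST S. input_containing A B C D S)"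

definition self_bounded ::
  "real^'n^'n \<Rightarrow> real^'m^'n \<Rightarrow> real^'n^'p \<Rightarrow> real^'m^'p \<Rightarrow> (real^'n) set \<Rightarrow> bool" where
  "self_bounded A B C D V \<longleftrightarrow>
     output_nulling A B C D V \<and>
     Vstar A B C D \<inter> (\<lambda>u. B *v u) ` ker (\<lambda>u. D *v u) \<subseteq> V"

definition self_hidden ::
  "real^'n^'n \<Rightarrow> real^'m^'n \<Rightarrow> real^'n^'p \<Rightarrow> real^'m^'p \<Rightarrow> (real^'n) set \<Rightarrow> bool" where
  "self_hidden A B C D S \<longleftrightarrow>
     input_containing A B C D S \<and>
     S \<subseteq> Sstar A B C D + (\<lambda>x. C *v x) -` range (\<lambda>u. D *v u)"

definition solution_triple ::
  "real^'n^'n \<Rightarrow> real^'m^'n \<Rightarrow> real^'q^'n \<Rightarrow>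
   real^'n^'p \<Rightarrow> real^'m^'p \<Rightarrow> real^'q^'p \<Rightarrow>
   real^'n^'r \<Rightarrow> real^'m^'r \<Rightarrow> real^'q^'r \<Rightarrow>
   (real^'n) set \<Rightarrow> (real^'n) set \<Rightarrow> real^'p^'m \<Rightarrow> bool" where
  "solution_triple A B H C Dy Gy E Dz Gz S V K \<longleftrightarrow>
     output_nulling A B E Dz V \<and>
     input_containing A H C Gy S \<and>
     range (block_col H Gz) \<subseteq> V \<times> {0} + range (block_col B Dz) \<and>
     (S \<times> UNIV) \<inter> ker (block_row C Gy) \<subseteq> ker (block_row E Gz) \<and>
     S \<subseteq> V \<and>
     invertible (mat 1 + K ** Dy) \<and>
     block_mat (A + B ** K ** C) (H + B ** K ** Gy)
               (E + Dz ** K ** C) (Gz + Dz ** K ** Gy) ` (S \<times> UNIV) \<subseteq> V \<times> {0}"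

lemma ex_greatest_output_nulling:
  fixes A :: "real^'n^'n" and B :: "real^'m^'n" and C :: "real^'n^'p" and D :: "real^'m^'p"
  shows "\<exists>M. output_nulling A B C D M \<and> (\<forall>V. output_nulling A B C D V \<longrightarrow> V \<subseteq> M)"
proof -
  define M where "M = span (\<Union>{V. output_nulling A B C D V})"
  have le: "V \<subseteq> M" if "output_nulling A B C D V" for V
    using that unfolding M_def by (auto intro: span_base)
  have subM: "subspace M"
    unfolding M_def by (rule subspace_span)
  have lin: "linear (block_col F G)" for F :: "real^'x^'y" and G :: "real^'x^'z"
    unfolding block_col_def
    by (intro linearI) (simp_all add: matrix_vector_right_distrib scaleR_matrix_vector_assoc matrix_vector_mult_scaleR)
  have "subspace (M \<times> {0::real^'p})"
    by (intro subspace_Times subM) (simp add: subspace_0 subspace_def)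
  moreover have "X + Y = {x + y |x y. x \<in> X \<and> y \<in> Y}"
    for X Y :: "((real^'n) \<times> (real^'p)) set"
    unfolding set_plus_def by blast
  ultimately have sub: "subspace (M \<times> {0} + range (block_col B D))"
    using subspace_sums[OF _ linear_subspace_image[OF lin subspace_UNIV]] by (simp only:)
  have "(\<Union>{V. output_nulling A B C D V}) \<subseteq> block_col A C -` (M \<times> {0} + range (block_col B D))"
  proof (rule Union_least)
    fix V assume "V \<in> {V. output_nulling A B C D V}"
    then have V: "output_nulling A B C D V" by simp
    then have "block_col A C ` V \<subseteq> V \<times> {0} + range (block_col B D)"
      by (simp add: output_nulling_def)
    also have "\<dots> \<subseteq> M \<times> {0} + range (block_col B D)"
      by (intro set_plus_mono2) (use le[OF V] in auto)
    finally show "V \<subseteq> block_col A C -` (M \<times> {0} + range (block_col B D))"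
      by auto
  qed
  then have "M \<subseteq> block_col A C -` (M \<times> {0} + range (block_col B D))"
    using span_minimal linear_subspace_vimage[OF lin sub] unfolding M_def by blast
  then show ?thesis
    using subM le unfolding output_nulling_def by (intro exI[of _ M]) blast
qed

lemma output_nulling_Vstar: "output_nulling A B C D (Vstar A B C D)"
  using ex_greatest_output_nulling[of A B C D] unfolding Vstar_def by (metis GreatestI2_order)

lemma Vstar_greatest: "output_nulling A B C D V \<Longrightarrow> V \<subseteq> Vstar A B C D"
  using ex_greatest_output_nulling[of A B C D] unfolding Vstar_def by (metis Greatest_equality)

lemma ex_least_input_containing:
  "\<exists>M. input_containing A B C D M \<and> (\<forall>S. input_containing A B C D S \<longrightarrow> M \<subseteq> S)"
proof -
  have "input_containing A B C D (\<Inter>{S. input_containing A B C D S})"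
    unfolding input_containing_def by (intro conjI subspace_Inter) blast+
  then show ?thesis by blast
qed

lemma input_containing_Sstar: "input_containing A B C D (Sstar A B C D)"
  using ex_least_input_containing[of A B C D] unfolding Sstar_def by (metis LeastI2_order)

lemma Sstar_least: "input_containing A B C D S \<Longrightarrow> Sstar A B C D \<subseteq> S"
  using ex_least_input_containing[of A B C D] unfolding Sstar_def by (metis Least_equality)

end

theory Submission
  imports Defs
begin

text \<open>
  Self hiddenness splits a state in \<open>S'\<close> into a part paired with a disturbance that makes
  the measurement vanish, on which \<open>K\<close> has no effect, and a part in \<open>Sstar\<close>, which lies
  in \<open>S\<close>. On the second part the given triple puts the closed-loop image in \<open>V\<close>, hence in
  \<open>Vstar\<close>. Modulo \<open>V'\<close> that image is of the form \<open>B *v u\<close> with \<open>Dz *v u = 0\<close>,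
  so self boundedness puts it in \<open>V'\<close>.
\<close>

text \<open>The feedback is regrouped so that \<open>K\<close> enters only through the measurement
  \<open>C *v x + G *v w\<close>; pairs with equal measurements then receive equal inputs.\<close>

lemma block_mat_feedback:
  fixes K :: "real^'p^'m"
  shows "block_mat (A + B ** K ** C) (H + B ** K ** G) (E + D ** K ** C) (F + D ** K ** G) (x, w) =
    (A *v x + H *v w + B *v (K *v (C *v x + G *v w)),
     E *v x + F *v w + D *v (K *v (C *v x + G *v w)))"
  by (simp add: block_mat_def block_row_def matrix_vector_mult_add_rdistrib
      matrix_vector_right_distrib matrix_vector_mul_assoc matrix_mul_assoc)

text \<open>By \<open>col\<close>, \<open>M *v x\<close> is some \<open>v\<close> in
  \<open>V\<close> plus \<open>B *v u1\<close>, with \<open>N *v x = D *v u1\<close>. Subtracting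
  \<open>v\<close>, which also lies in \<open>Vstar\<close>, leaves \<open>B *v (u1 + u)\<close>
  inside \<open>Vstar\<close>, and \<open>null\<close> puts \<open>u1 + u\<close> in the kernel of
  \<open>D\<close>. Self boundedness then applies.\<close>

lemma self_bounded_absorb:
  assumes sb: "self_bounded A B E D V"
    and col: "block_col M N x \<in> V \<times> {0} + range (block_col B D)"
    and star: "M *v x + B *v u \<in> Vstar A B E D"
    and null: "N *v x + D *v u = 0"
  shows "M *v x + B *v u \<in> V"
proof -
  have nulling: "output_nulling A B E D V"
    and inter: "Vstar A B E D \<inter> (\<lambda>u. B *v u) ` ker (\<lambda>u. D *v u) \<subseteq> V"
    using sb by (auto simp: self_bounded_def)
  have subV: "subspace V" and subVs: "subspace (Vstar A B E D)"
    using nulling output_nulling_Vstar by (auto simp: output_nulling_def)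
  obtain v u1 where v: "v \<in> V" and M: "M *v x = v + B *v u1" and N: "N *v x = D *v u1"
    using col by (auto simp: block_col_def elim!: set_plus_elim)
  have "M *v x + B *v u - v \<in> Vstar A B E D"
    using star v Vstar_greatest[OF nulling] by (intro subspace_diff subVs) auto
  moreover have "M *v x + B *v u - v = B *v (u1 + u)"
    by (simp add: M matrix_vector_right_distrib)
  moreover have "D *v (u1 + u) = 0"
    using null by (simp add: N matrix_vector_right_distrib)
  ultimately have "M *v x + B *v u - v \<in> V"
    using inter by (auto simp: ker_def)
  from subspace_add[OF subV this v] show ?thesis by simp
qed

theorem theorem3:
  fixes A :: "real^'n^'n" and B :: "real^'m^'n" and H :: "real^'q^'n"
    and C :: "real^'n^'p" and Dy :: "real^'m^'p" and Gy :: "real^'q^'p"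
    and E :: "real^'n^'r" and Dz :: "real^'m^'r" and Gz :: "real^'q^'r"
    and S V S' V' :: "(real^'n) set" and K :: "real^'p^'m"
  assumes "self_hidden A H C Gy S"
    and "self_bounded A B E Dz V"
    and "solution_triple A B H C Dy Gy E Dz Gz S V K"
    and "self_hidden A H C Gy S'"
    and "self_bounded A B E Dz V'"
    and "range (block_col H Gz) \<subseteq> V' \<times> {0} + range (block_col B Dz)"
    and "(S' \<times> UNIV) \<inter> ker (block_row C Gy) \<subseteq> ker (block_row E Gz)"
    and "S' \<subseteq> V'"
  shows "solution_triple A B H C Dy Gy E Dz Gz S' V' K"
proof -
  let ?F = "block_mat (A + B ** K ** C) (H + B ** K ** Gy)
               (E + Dz ** K ** C) (Gz + Dz ** K ** Gy)"
  let ?u = "\<lambda>x w. K *v (C *v x + Gy *v w)"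
  have onV: "output_nulling A B E Dz V" and icS: "input_containing A H C Gy S"
    and inv: "invertible (mat 1 + K ** Dy)" and FS: "?F ` (S \<times> UNIV) \<subseteq> V \<times> {0}"
    using assms(3) by (auto simp: solution_triple_def)
  have icS': "input_containing A H C Gy S'"
    and hid: "S' \<subseteq> Sstar A H C Gy + (\<lambda>x. C *v x) -` range (\<lambda>u. Gy *v u)"
    using assms(4) by (auto simp: self_hidden_def)
  have onV': "output_nulling A B E Dz V'"
    using assms(5) by (simp add: self_bounded_def)
  have subS': "subspace S'" and subV': "subspace V'"
    using icS' onV' by (auto simp: input_containing_def output_nulling_def)
  \<comment> \<open>The disturbance stays arbitrary here because the claim is needed below at
    \<open>w + w0\<close>.\<close>
  have star: "A *v s + H *v w + B *v ?u s w \<in> V' \<and> E *v s + Gz *v w + Dz *v ?u s w = 0"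
    if s: "s \<in> Sstar A H C Gy" for s w
  proof -
    have "s \<in> S" using s Sstar_least[OF icS] by blast
    then have "?F (s, w) \<in> V \<times> {0}" using FS by blast
    then have inV: "A *v s + H *v w + B *v ?u s w \<in> V"
      and null: "E *v s + Gz *v w + Dz *v ?u s w = 0"
      by (auto simp: block_mat_feedback)
    \<comment> \<open>Output nulling of \<open>V'\<close> trades \<open>A *v s\<close> for the input
      \<open>u1\<close>, up to a term in \<open>V'\<close>. Only the disturbance column is then left
      for \<open>self_bounded_absorb\<close>, with total input \<open>u1 + ?u s w\<close>.\<close>
    have "s \<in> V'" using s Sstar_least[OF icS'] assms(8) by blast
    then obtain v1 u1 where v1: "v1 \<in> V'" and A: "A *v s = v1 + B *v u1" and E: "E *v s = Dz *v u1"
      using onV' by (fastforce simp: output_nulling_def block_col_def elim!: set_plus_elim)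
    have Bs: "H *v w + B *v (u1 + ?u s w) = A *v s + H *v w + B *v ?u s w - v1"
      by (simp add: A matrix_vector_right_distrib)
    have "H *v w + B *v (u1 + ?u s w) \<in> V'"
    proof (rule self_bounded_absorb[OF assms(5)])
      show "block_col H Gz w \<in> V' \<times> {0} + range (block_col B Dz)"
        using assms(6) by blast
      \<comment> \<open>The closed-loop image lies in \<open>V\<close> and \<open>v1\<close> in
        \<open>V'\<close>; \<open>Vstar\<close> contains both subspaces, hence the
        difference.\<close>
      show "H *v w + B *v (u1 + ?u s w) \<in> Vstar A B E Dz"
        unfolding Bs using inV v1 Vstar_greatest[OF onV] Vstar_greatest[OF onV']
          output_nulling_Vstar[of A B E Dz]
        by (intro subspace_diff) (auto simp: output_nulling_def)
      show "Gz *v w + Dz *v (u1 + ?u s w) = 0"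
        using null by (simp add: E matrix_vector_right_distrib algebra_simps)
    qed
    from subspace_add[OF subV' this[unfolded Bs] v1] null show ?thesis by simp
  qed
  have "?F (x, w) \<in> V' \<times> {0}" if x: "x \<in> S'" for x w
  proof -
    obtain s t w0 where s: "s \<in> Sstar A H C Gy" and t: "C *v t = Gy *v w0" and xst: "x = s + t"
      using x hid by (fastforce elim!: set_plus_elim)
    have "t = x - s" "s \<in> S'" using xst s Sstar_least[OF icS'] by auto
    then have tS: "t \<in> S'" using x subspace_diff[OF subS'] by blast
    \<comment> \<open>The sign of \<open>w0\<close> cancels the measurement of \<open>t\<close>, so
      input containment and the kernel inclusion both apply to this pair.\<close>
    have mem: "(t, - w0) \<in> (S' \<times> UNIV) \<inter> ker (block_row C Gy)"
      using tS t by (simp add: ker_def block_row_def linear_neg[OF matrix_vector_mul_linear])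
    have "block_row A H (t, - w0) \<in> S'"
      using icS' mem unfolding input_containing_def by blast
    then have AH: "A *v t - H *v w0 \<in> V'"
      using assms(8) by (auto simp: block_row_def linear_neg[OF matrix_vector_mul_linear])
    have "(t, - w0) \<in> ker (block_row E Gz)"
      using assms(7) mem by blast
    then have EG: "E *v t = Gz *v w0"
      by (auto simp: ker_def block_row_def linear_neg[OF matrix_vector_mul_linear])
    \<comment> \<open>The pair \<open>(x, w)\<close> is \<open>(s, w + w0)\<close> plus
      \<open>(t, - w0)\<close>; the second summand has zero measurement, so both sides feed the same
      vector to \<open>K\<close>.\<close>
    have u: "?u x w = ?u s (w + w0)"
      by (simp add: xst t matrix_vector_right_distrib algebra_simps)
    have "A *v x + H *v w + B *v ?u x w =
        (A *v s + H *v (w + w0) + B *v ?u s (w + w0)) + (A *v t - H *v w0)"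
      unfolding u by (simp add: xst matrix_vector_right_distrib)
    then have "A *v x + H *v w + B *v ?u x w \<in> V'"
      using subspace_add[OF subV' conjunct1[OF star[OF s]] AH] by simp
    moreover have "E *v x + Gz *v w + Dz *v ?u x w =
        E *v s + Gz *v (w + w0) + Dz *v ?u s (w + w0)"
      unfolding u by (simp add: xst EG matrix_vector_right_distrib)
    ultimately show ?thesis
      using star[OF s] by (simp add: block_mat_feedback)
  qed
  then show ?thesis
    using onV' icS' inv assms(6-8) unfolding solution_triple_def by blast
qed

end
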